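(* Let $G$ be a graph and let $r$ be an integer with $3\leq r\leq\omega(G)$. Then there exists a vertex $u$ in $G$ such that $$\rho_{r-1}(G_u)\geq (r-1)\gamma_r(G)$$ and $G$ has $p=\left\lceil (r-1)\gamma_r(G)\right\rceil$ distinct $r$-cliques $C_1,\ldots,C_p$ such that $u\in C_1\cap\cdots\cap C_p$ and $$|C_1\cap\cdots\cap C_p|\geq 2.$$
   Context: Graphs are finite and simple. A clique of a graph $G$ is a set of vertices inducing a complete graph; an $r$-clique is a clique with $r$ vertices; $C_r(G)$ is the set of $r$-cliques of $G$; $\omega(G)$ is the maximum size of a clique. The $r$-clique tensor $\mathcal{A}_r(G)=(a_{i_1\cdots i_r})$ is the $r$-order $|V(G)|$-dimension tensor with $a_{i_1\cdots i_r}=\frac{1}{(r-1)!}$ if $\{i_1,\ldots,i_r\}\in C_r(G)$ and $0$ otherwise. For an $m$-order $n$-dimension tensor $\mathcal{A}=(a_{i_1\cdots i_m})$ and $x\in\mathbb{C}^n$, $\mathcal{A}x^{m-1}\in\mathbb{C}^n$ is the vector with $i$-th component $\sum_{i_2,\ldots,i_m=1}^n a_{ii_2\cdots i_m}x_{i_2}\cdots x_{i_m}$; $\lambda\in\mathbb{C}$ is an eigenvalue of $\mathcal{A}$ if $\mathcal{A}x^{m-1}=\lambda x^{[m-1]}$ for some nonzero $x\in\mathbb{C}^n$, where $x^{[m-1]}=(x_1^{m-1},\ldots,x_n^{m-1})^\top$; the spectral radius of $\mathcal{A}$ is the largest modulus of its eigenvalues. The $r$-clique spectral radius $\rho_r(G)$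 is the spectral radius of $\mathcal{A}_r(G)$ (so $\rho_2(G)$ is the spectral radius of the adjacency matrix of $G$). Let $\gamma_r(G)=\rho_r(G)/\rho_2(H)$, where $H$ is the subgraph of $G$ obtained by deleting all edges that are not contained in an $r$-clique of $G$. For a vertex $u$ of $G$, $G_u$ denotes the subgraph of $G$ induced by the open neighborhood $N_G(u)=\{v: vu\in E(G)\}$. *)

theory Defs
  imports Complex_Main "Graph_Theory.Graph_Theory"
begin

text \<open>
  A finite simple graph is a digraph satisfying the locale predicate \<^const>\<open>graph\<close>
  (finite, loop-free, no parallel arcs, symmetric); an undirected edge is represented by a pair
  of opposite arcs.
\<close>

definition cliques :: "nat \<Rightarrow> ('a, 'b) pre_digraph \<Rightarrow> 'a set set" where
  "cliques r G = {S. S \<subseteq> verts G \<and> complete_digraph r (G \<restriction> S)}"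

definition clique_number :: "('a, 'b) pre_digraph \<Rightarrow> nat" where
  "clique_number G = Max {r. cliques r G \<noteq> {}}"

text \<open>
  A tensor of order \<open>m\<close> whose indices range over a finite set \<open>I\<close> (so its dimension is
  \<open>card I\<close>) is a function on index lists, of which only the values on lists of length \<open>m\<close>
  with entries in \<open>I\<close> matter. Likewise only the values on \<open>I\<close> of a vector \<open>x\<close> matter.
\<close>

definition tensor_apply ::
  "'a set \<Rightarrow> nat \<Rightarrow> ('a list \<Rightarrow> complex) \<Rightarrow> ('a \<Rightarrow> complex) \<Rightarrow> 'a \<Rightarrow> complex" where
  "tensor_apply I m A x i =
     (\<Sum>js \<in> {js. set js \<subseteq> I \<and> length js = m - 1}. A (i # js) * prod_list (map x js))"

definition tensor_eigenvalue ::
  "'a set \<Rightarrow> nat \<Rightarrow> ('a list \<Rightarrow> complex) \<Rightarrow> complex \<Rightarrow> bool" where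
  "tensor_eigenvalue I m A \<mu> \<longleftrightarrow>
     (\<exists>x. (\<exists>i\<in>I. x i \<noteq> 0) \<and> (\<forall>i\<in>I. tensor_apply I m A x i = \<mu> * x i ^ (m - 1)))"

text \<open>
  \<^const>\<open>Greatest\<close> is used instead of \<^const>\<open>Max\<close> because the latter is only specified on sets
  already known to be finite. A tensor of dimension 0 has no eigenvalues; its spectral radius is
  0 by convention.
\<close>

definition tensor_spectral_radius :: "'a set \<Rightarrow> nat \<Rightarrow> ('a list \<Rightarrow> complex) \<Rightarrow> real" where
  "tensor_spectral_radius I m A =
     (if I = {} then 0 else (GREATEST \<rho>. \<exists>\<mu>. tensor_eigenvalue I m A \<mu> \<and> \<rho> = cmod \<mu>))"

definition clique_tensor :: "nat \<Rightarrow> ('a, 'b) pre_digraph \<Rightarrow> 'a list \<Rightarrow> complex" where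
  "clique_tensor r G is = (if set is \<in> cliques r G then 1 / fact (r - 1) else 0)"

definition clique_spectral_radius :: "nat \<Rightarrow> ('a, 'b) pre_digraph \<Rightarrow> real" where
  "clique_spectral_radius r G = tensor_spectral_radius (verts G) r (clique_tensor r G)"

definition clique_edge_subgraph :: "nat \<Rightarrow> ('a, 'b) pre_digraph \<Rightarrow> ('a, 'b) pre_digraph" where
  "clique_edge_subgraph r G =
     G\<lparr>arcs := {e \<in> arcs G. \<exists>K \<in> cliques r G. tail G e \<in> K \<and> head G e \<in> K}\<rparr>"

definition clique_ratio :: "nat \<Rightarrow> ('a, 'b) pre_digraph \<Rightarrow> real" where
  "clique_ratio r G =
     clique_spectral_radius r G / clique_spectral_radius 2 (clique_edge_subgraph r G)"

definition neighborhood_subgraph :: "('a, 'b) pre_digraph \<Rightarrow> 'a \<Rightarrow> ('a, 'b) pre_digraph" where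
  "neighborhood_subgraph G u = G \<restriction> {v. (v, u) \<in> arcs_ends G}"

end

(*
  The form y |-> r * (sum over r-cliques S of the product of y over S) attains its maximum on the
  nonnegative part of the unit sphere of the r-norm at a nonnegative eigenvector x with eigenvalue
  rho_r(G); hence rho_r(G) bounds the form by the r-th power norm. Apply this to each G_u: the
  eigenvalue equation of G at u is a sum over the (r-1)-cliques of G_u, so with z_v = x_v^(r-1)
    (r-1) * rho_r(G) * z_u <= rho_{r-1}(G_u) * (sum of z_v over the neighbours v of u in H).
  Multiplying by z_u, summing over u and bounding the quadratic form of H by rho_2(H) gives
  (r-1) * rho_r(G) <= max_u rho_{r-1}(G_u) * rho_2(H). Evaluating the eigenvalue equation of G_u
  at a largest entry of its eigenvector yields a vertex v in at least rho_{r-1}(G_u) of the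
  (r-1)-cliques of G_u, and adjoining u turns these into r-cliques of G containing u and v.
*)

theory Submission
  imports Defs "HOL-Analysis.Function_Topology" "HOL-Combinatorics.Multiset_Permutations"
begin

section \<open>One-variable minimization\<close>

text \<open>A positive minimizer is a critical point. At \<open>a = 0\<close> only the comparison
  from the right is available: dividing it by \<open>t\<close> and letting \<open>t\<close> tend to
  0 gives \<open>D\<close> \<le> 0.\<close>

lemma deriv_zero_of_power_minimum:
  fixes l D a :: real
  assumes "2 \<le> r" "0 \<le> a" "0 \<le> D"
    and min: "\<And>t. 0 \<le> t \<Longrightarrow> l * a ^ r - real r * (a * D) \<le> l * t ^ r - real r * (t * D)"
  shows "D = l * a ^ (r - 1)"
proof (cases "a = 0")
  case False
  with assms have "0 < a" by simp
  have "((\<lambda>t. l * t ^ r - real r * (t * D)) has_real_derivative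
      l * (real r * a ^ (r - Suc 0)) - real r * D) (at a)"
    by (auto intro!: derivative_eq_intros)
  then have "l * (real r * a ^ (r - Suc 0)) - real r * D = 0"
    by (rule DERIV_local_min[where d = a]) (use \<open>0 < a\<close> in \<open>auto intro!: min\<close>)
  then have "real r * (l * a ^ (r - 1) - D) = 0"
    by (simp add: algebra_simps)
  with \<open>2 \<le> r\<close> show ?thesis by simp
next
  case True
  have "real r * D \<le> l * t ^ (r - 1)" if "0 < t" for t
  proof -
    have "t * (real r * D) \<le> t * (l * t ^ (r - 1))"
      using min[of t] that True \<open>2 \<le> r\<close>
      by (simp add: zero_power power_eq_if[of t r] algebra_simps)
    then show ?thesis using that by simp
  qed
  then have "eventually (\<lambda>t. real r * D \<le> l * t ^ (r - 1)) (at_right 0)"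
    by (auto intro: eventually_mono[OF eventually_at_right_less])
  moreover have "((\<lambda>t. l * t ^ (r - 1)) \<longlongrightarrow> l * 0 ^ (r - 1)) (at_right 0)"
    by (intro tendsto_intros)
  ultimately have "real r * D \<le> l * 0 ^ (r - 1)"
    using tendsto_lowerbound trivial_limit_at_right_real by blast
  then have "real r * D \<le> 0" using \<open>2 \<le> r\<close> by (simp add: zero_power)
  then have "D \<le> 0" using \<open>2 \<le> r\<close> by (simp add: mult_le_0_iff)
  with \<open>0 \<le> D\<close> True \<open>2 \<le> r\<close> show ?thesis by (simp add: zero_power)
qed


section \<open>Forms and tensors of uniform set families\<close>

text \<open>The partial derivative in direction \<open>i\<close> of the form that sums, over the
  members of \<open>F\<close>, the products of their entries. The general semiring covers both
  complex eigenvectors and real nonnegative vectors.\<close>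

definition link_sum :: "'a set set \<Rightarrow> ('a \<Rightarrow> 'c::comm_semiring_1) \<Rightarrow> 'a \<Rightarrow> 'c" where
  "link_sum F x i = (\<Sum>S\<in>{S \<in> F. i \<in> S}. \<Prod>j\<in>S - {i}. x j)"

text \<open>Abstracting the clique tensor from the graph lets one theory serve the
  \<open>r\<close>-cliques of \<open>G\<close>, the \<open>(r - 1)\<close>-cliques of a neighborhood
  and the edges of \<open>H\<close>.\<close>

definition family_tensor :: "nat \<Rightarrow> 'a set set \<Rightarrow> 'a list \<Rightarrow> complex" where
  "family_tensor r F is = (if set is \<in> F then 1 / fact (r - 1) else 0)"

lemma link_sum_of_real:
  "link_sum F (\<lambda>i. of_real (x i)) i = (of_real (link_sum F x i) :: complex)"
  by (simp add: link_sum_def)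

lemma link_sum_nonneg:
  fixes x :: "'a \<Rightarrow> real"
  assumes "\<And>S j. S \<in> F \<Longrightarrow> j \<in> S \<Longrightarrow> 0 \<le> x j"
  shows "0 \<le> link_sum F x i"
  unfolding link_sum_def using assms by (auto intro!: sum_nonneg prod_nonneg)

locale uniform_family =
  fixes V :: "'a set" and F :: "'a set set" and r :: nat
  assumes finite_V: "finite V"
    and two_le_r: "2 \<le> r"
    and subset_V: "S \<in> F \<Longrightarrow> S \<subseteq> V"
    and card_eq: "S \<in> F \<Longrightarrow> card S = r"
begin

lemma finite_F: "finite F"
  using subset_V finite_V by (meson finite_Pow_iff finite_subset Pow_iff subsetI)

lemma finite_member: "S \<in> F \<Longrightarrow> finite S"
  using subset_V finite_V finite_subset by blast

text \<open>Only the repetition-free enumerations of the sets \<open>S - {i}\<close> contribute, and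
  the \<open>(r - 1)!\<close> enumerations of each set cancel the normalizing factor of the
  tensor.\<close>

lemma tensor_apply_family:
  assumes "i \<in> V"
  shows "tensor_apply V r (family_tensor r F) x i = link_sum F x i"
proof -
  let ?L = "{js. set js \<subseteq> V \<and> length js = r - 1}"
  let ?Fi = "{S \<in> F. i \<in> S}"
  let ?U = "\<Union>S\<in>?Fi. permutations_of_set (S - {i})"
  let ?g = "\<lambda>js. family_tensor r F (i # js) * prod_list (map x js)"
  have finite_L: "finite ?L"
    using finite_V by (rule finite_lists_length_eq)
  have "?U \<subseteq> ?L"
  proof
    fix js assume "js \<in> ?U"
    then obtain S where S: "S \<in> F" "i \<in> S" and js: "set js = S - {i}" "distinct js"
      by (auto simp: permutations_of_set_def)
    have "length js = r - 1"
      using distinct_card[OF js(2)] S card_eq by (simp add: js(1) card_Diff_singleton)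
    then show "js \<in> ?L" using js(1) subset_V[OF S(1)] by blast
  qed
  have outside: "?g js = 0" if "js \<in> ?L - ?U" for js
  proof (cases "set (i # js) \<in> F")
    case True
    \<comment> \<open>A list of \<open>r - 1\<close> entries reaches \<open>r\<close> elements
      together with \<open>i\<close> only if its entries are distinct and differ from
      \<open>i\<close>.\<close>
    then have "card (insert i (set js)) = r" using card_eq by simp
    moreover have "card (set js) \<le> r - 1" using that card_length[of js] by auto
    ultimately have c: "i \<notin> set js \<and> card (set js) = r - 1"
      using two_le_r by (auto simp: card_insert_if split: if_splits)
    then have "js \<in> permutations_of_set (set (i # js) - {i})"
      using that by (auto simp: permutations_of_set_def intro: card_distinct)
    then have "js \<in> ?U" using True by (intro UN_I[of "set (i # js)"]) auto
    with that show ?thesis by blast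
  qed (simp add: family_tensor_def)
  have inner: "(\<Sum>js\<in>permutations_of_set (S - {i}). ?g js) = (\<Prod>j\<in>S - {i}. x j)"
    if "S \<in> ?Fi" for S
  proof -
    have "?g js = (\<Prod>j\<in>S - {i}. x j) / fact (r - 1)"
      if "js \<in> permutations_of_set (S - {i})" for js
      using that \<open>S \<in> ?Fi\<close> permutations_of_setD[OF that]
      by (auto simp: family_tensor_def insert_absorb prod.distinct_set_conv_list[symmetric])
    moreover have "card (permutations_of_set (S - {i})) = fact (r - 1)"
      using that finite_member card_eq by (simp add: card_Diff_singleton)
    ultimately show ?thesis by simp
  qed
  have "tensor_apply V r (family_tensor r F) x i = (\<Sum>js\<in>?U. ?g js)"
    unfolding tensor_apply_def
    by (rule sum.mono_neutral_right[OF finite_L \<open>?U \<subseteq> ?L\<close>]) (use outside in blast)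
  also have "\<dots> = (\<Sum>S\<in>?Fi. \<Sum>js\<in>permutations_of_set (S - {i}). ?g js)"
  proof (rule sum.UNION_disjoint)
    show "\<forall>S\<in>?Fi. \<forall>T\<in>?Fi. S \<noteq> T \<longrightarrow>
        permutations_of_set (S - {i}) \<inter> permutations_of_set (T - {i}) = {}"
      by (auto simp: permutations_of_set_def)
  qed (use finite_F in auto)
  also have "\<dots> = link_sum F x i"
    unfolding link_sum_def using inner by (intro sum.cong) auto
  finally show ?thesis .
qed

text \<open>Double counting, or Euler's identity for a form of degree \<open>r\<close>: the product
  over \<open>S\<close> arises once for each of the \<open>r\<close> elements of
  \<open>S\<close>.\<close>

lemma sum_mult_link_sum:
  fixes y :: "'a \<Rightarrow> 'c::comm_semiring_1"
  shows "(\<Sum>i\<in>V. y i * link_sum F y i) = of_nat r * (\<Sum>S\<in>F. \<Prod>j\<in>S. y j)"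
proof -
  have "(\<Sum>i\<in>V. y i * link_sum F y i)
      = (\<Sum>i\<in>V. \<Sum>S\<in>{S \<in> F. i \<in> S}. y i * (\<Prod>j\<in>S - {i}. y j))"
    by (simp add: link_sum_def sum_distrib_left)
  also have "\<dots> = (\<Sum>i\<in>V. \<Sum>S\<in>{S \<in> F. i \<in> S}. \<Prod>j\<in>S. y j)"
    using finite_member by (intro sum.cong) (auto simp: prod.remove)
  also have "\<dots> = (\<Sum>S\<in>F. \<Sum>i\<in>{i \<in> V. i \<in> S}. \<Prod>j\<in>S. y j)"
    by (rule sum.swap_restrict[OF finite_V finite_F])
  also have "\<dots> = (\<Sum>S\<in>F. of_nat r * (\<Prod>j\<in>S. y j))"
  proof (rule sum.cong)
    fix S assume "S \<in> F"
    then have "{i \<in> V. i \<in> S} = S" using subset_V by blast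
    then show "(\<Sum>i\<in>{i \<in> V. i \<in> S}. \<Prod>j\<in>S. y j) = of_nat r * (\<Prod>j\<in>S. y j)"
      using card_eq \<open>S \<in> F\<close> by simp
  qed simp
  finally show ?thesis by (simp add: sum_distrib_left)
qed

text \<open>The form is affine in each single coordinate, because every monomial is
  square-free.\<close>

lemma sum_prod_update:
  fixes y :: "'a \<Rightarrow> real"
  shows "(\<Sum>S\<in>F. \<Prod>j\<in>S. (y(i := t)) j)
    = (\<Sum>S\<in>{S \<in> F. i \<notin> S}. \<Prod>j\<in>S. y j) + t * link_sum F y i"
proof -
  have F_split: "F = {S \<in> F. i \<notin> S} \<union> {S \<in> F. i \<in> S}" by blast
  have "(\<Sum>S\<in>F. \<Prod>j\<in>S. (y(i := t)) j) = (\<Sum>S\<in>{S \<in> F. i \<notin> S}. \<Prod>j\<in>S. (y(i := t)) j)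
      + (\<Sum>S\<in>{S \<in> F. i \<in> S}. \<Prod>j\<in>S. (y(i := t)) j)"
    using finite_F by (subst F_split, subst sum.union_disjoint) auto
  moreover have "(\<Sum>S\<in>{S \<in> F. i \<notin> S}. \<Prod>j\<in>S. (y(i := t)) j)
      = (\<Sum>S\<in>{S \<in> F. i \<notin> S}. \<Prod>j\<in>S. y j)"
    by (intro sum.cong prod.cong) auto
  moreover have "(\<Prod>j\<in>S. (y(i := t)) j) = t * (\<Prod>j\<in>S - {i}. y j)"
    if "S \<in> {S \<in> F. i \<in> S}" for S
  proof -
    have "(\<Prod>j\<in>S. (y(i := t)) j) = (y(i := t)) i * (\<Prod>j\<in>S - {i}. (y(i := t)) j)"
      using that finite_member by (intro prod.remove) auto
    also have "(\<Prod>j\<in>S - {i}. (y(i := t)) j) = (\<Prod>j\<in>S - {i}. y j)"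
      by (intro prod.cong) auto
    finally show ?thesis by simp
  qed
  then have "(\<Sum>S\<in>{S \<in> F. i \<in> S}. \<Prod>j\<in>S. (y(i := t)) j) = t * link_sum F y i"
    by (simp add: link_sum_def sum_distrib_left)
  ultimately show ?thesis by simp
qed

section \<open>Variational principle and Perron vectors\<close>

text \<open>A continuous form attains its maximum on a compact set. The work lies in finding that
  set among functions on the whole type.\<close>

lemma ex_maximizer_on_sphere:
  assumes "V \<noteq> {}"
  shows "\<exists>x. (\<forall>i\<in>V. 0 \<le> x i) \<and> (\<Sum>i\<in>V. x i ^ r) = 1 \<and>
    (\<forall>y. (\<forall>i\<in>V. 0 \<le> y i) \<longrightarrow> (\<Sum>i\<in>V. y i ^ r) = 1 \<longrightarrow>
      (\<Sum>S\<in>F. \<Prod>j\<in>S. y j) \<le> (\<Sum>S\<in>F. \<Prod>j\<in>S. x j :: real))"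
proof -
  \<comment> \<open>Coordinates outside \<open>V\<close> are pinned to 0, so the box is a product of
    compact sets and hence compact.\<close>
  let ?B = "PiE UNIV (\<lambda>i. if i \<in> V then {0..1::real} else {0})"
  let ?K = "?B \<inter> {x. (\<Sum>i\<in>V. x i ^ r) = 1}"
  have coord: "continuous_on UNIV (\<lambda>x::'a \<Rightarrow> real. x i)" for i
    by (rule continuous_on_product_coordinates)
  have "compactin (product_topology (\<lambda>_::'a. euclidean :: real topology) UNIV) ?B"
    by (subst compactin_PiE) auto
  then have "compact ?B"
    by (simp add: euclidean_product_topology)
  moreover have "closed {x::'a \<Rightarrow> real. (\<Sum>i\<in>V. x i ^ r) = 1}"
    by (intro closed_Collect_eq continuous_intros coord)
  ultimately have "compact ?K"
    by (rule compact_Int_closed)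
  moreover have "?K \<noteq> {}"
  proof -
    obtain v where "v \<in> V" using assms by blast
    have "(\<Sum>i\<in>V. (if i = v then 1 else 0 :: real) ^ r) = (\<Sum>i\<in>V. if i = v then 1 else 0)"
      using two_le_r by (intro sum.cong) (auto simp: zero_power)
    then have "(\<lambda>i. if i = v then 1 else 0) \<in> ?K"
      using \<open>v \<in> V\<close> finite_V by (auto simp: PiE_iff)
    then show ?thesis by blast
  qed
  moreover have "continuous_on ?K (\<lambda>x. \<Sum>S\<in>F. \<Prod>j\<in>S. x j :: real)"
    by (intro continuous_intros continuous_on_subset[OF coord]) auto
  ultimately obtain x where "x \<in> ?K"
    and max: "\<And>y. y \<in> ?K \<Longrightarrow> (\<Sum>S\<in>F. \<Prod>j\<in>S. y j) \<le> (\<Sum>S\<in>F. \<Prod>j\<in>S. x j)"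
    using continuous_attains_sup by (metis (no_types, lifting))
  show ?thesis
  proof (intro exI[of _ x] conjI allI impI)
    show "\<forall>i\<in>V. 0 \<le> x i" "(\<Sum>i\<in>V. x i ^ r) = 1"
      using \<open>x \<in> ?K\<close> by (auto simp: PiE_iff split: if_splits)
  next
    fix y :: "'a \<Rightarrow> real"
    assume y: "\<forall>i\<in>V. 0 \<le> y i" "(\<Sum>i\<in>V. y i ^ r) = 1"
    \<comment> \<open>The values of \<open>y\<close> outside \<open>V\<close> are arbitrary;
      resetting them to 0 moves \<open>y\<close> into \<open>?K\<close> and leaves the form
      unchanged.\<close>
    let ?z = "\<lambda>i. if i \<in> V then y i else 0"
    have "y i \<le> 1" if "i \<in> V" for i
    proof -
      have "y i ^ r \<le> (\<Sum>i\<in>V. y i ^ r)"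
        using that y finite_V by (intro member_le_sum) auto
      then show ?thesis using y that two_le_r by (simp add: power_le_one_iff)
    qed
    then have "?z \<in> ?K" using y by auto
    moreover have "(\<Prod>j\<in>S. ?z j) = (\<Prod>j\<in>S. y j)" if "S \<in> F" for S
      using subset_V[OF that] by (intro prod.cong) auto
    ultimately show "(\<Sum>S\<in>F. \<Prod>j\<in>S. y j) \<le> (\<Sum>S\<in>F. \<Prod>j\<in>S. x j)"
      using max[of ?z] by simp
  qed
qed

text \<open>The Lagrange condition holds at zero coordinates of the maximizer as well: there the form
  would grow linearly and the \<open>r\<close>-th power norm only to order \<open>r \<ge> 2\<close>.\<close>

lemma ex_perron_pair:
  assumes "V \<noteq> {}"
  shows "\<exists>l x. 0 \<le> l \<and> (\<forall>i\<in>V. 0 \<le> x i) \<and> (\<exists>i\<in>V. x i \<noteq> 0) \<and>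
    (\<forall>i\<in>V. link_sum F x i = l * x i ^ (r - 1)) \<and>
    (\<forall>y. (\<forall>i\<in>V. 0 \<le> y i) \<longrightarrow> real r * (\<Sum>S\<in>F. \<Prod>j\<in>S. y j) \<le> l * (\<Sum>i\<in>V. y i ^ r))"
proof -
  obtain x :: "'a \<Rightarrow> real" where x0: "\<And>i. i \<in> V \<Longrightarrow> 0 \<le> x i"
    and x1: "(\<Sum>i\<in>V. x i ^ r) = 1"
    and max: "\<And>y. \<lbrakk>\<forall>i\<in>V. 0 \<le> y i; (\<Sum>i\<in>V. y i ^ r) = 1\<rbrakk> \<Longrightarrow>
      (\<Sum>S\<in>F. \<Prod>j\<in>S. y j) \<le> (\<Sum>S\<in>F. \<Prod>j\<in>S. x j)"
    using ex_maximizer_on_sphere[OF assms] by blast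
  define l where "l = real r * (\<Sum>S\<in>F. \<Prod>j\<in>S. x j)"
  have "0 \<le> l"
    unfolding l_def using subset_V x0 by (intro mult_nonneg_nonneg sum_nonneg prod_nonneg) auto
  have bound: "real r * (\<Sum>S\<in>F. \<Prod>j\<in>S. y j) \<le> l * (\<Sum>i\<in>V. y i ^ r)"
    if y0: "\<forall>i\<in>V. 0 \<le> y i" for y
  proof (cases "(\<Sum>i\<in>V. y i ^ r) = 0")
    case True
    then have "\<forall>i\<in>V. y i = 0"
      using y0 finite_V two_le_r by (subst (asm) sum_nonneg_eq_0_iff) auto
    then have "(\<Prod>j\<in>S. y j) = 0" if "S \<in> F" for S
    proof -
      have "S \<noteq> {}" using card_eq[OF that] two_le_r by auto
      then show ?thesis
        using finite_member[OF that] subset_V[OF that] \<open>\<forall>i\<in>V. y i = 0\<close>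
        by (meson ex_in_conv prod_zero subsetD)
    qed
    then show ?thesis using True by simp
  next
    case False
    define s where "s = (\<Sum>i\<in>V. y i ^ r)"
    \<comment> \<open>Division by \<open>c\<close> moves \<open>y\<close> to the unit sphere. Both
      sides of the bound are homogeneous of degree \<open>r\<close>, so it scales back.\<close>
    define c where "c = root r s"
    have "0 < s"
      using False y0 unfolding s_def by (simp add: less_le sum_nonneg)
    then have "0 < c" "c ^ r = s"
      using two_le_r by (auto simp: c_def)
    have "(\<Sum>i\<in>V. (y i / c) ^ r) = 1"
      using \<open>0 < s\<close> \<open>c ^ r = s\<close>
      by (simp add: power_divide s_def[symmetric] sum_divide_distrib[symmetric])
    then have "(\<Sum>S\<in>F. \<Prod>j\<in>S. y j / c) \<le> (\<Sum>S\<in>F. \<Prod>j\<in>S. x j)"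
      using y0 \<open>0 < c\<close> by (intro max) auto
    moreover have "(\<Sum>S\<in>F. \<Prod>j\<in>S. y j / c) = (\<Sum>S\<in>F. (\<Prod>j\<in>S. y j) / s)"
      using card_eq \<open>c ^ r = s\<close> by (intro sum.cong) (auto simp: prod_dividef)
    ultimately have "(\<Sum>S\<in>F. \<Prod>j\<in>S. y j) / s \<le> (\<Sum>S\<in>F. \<Prod>j\<in>S. x j)"
      by (simp add: sum_divide_distrib)
    then have "(\<Sum>S\<in>F. \<Prod>j\<in>S. y j) \<le> (\<Sum>S\<in>F. \<Prod>j\<in>S. x j) * s"
      using \<open>0 < s\<close> by (simp add: field_simps)
    then show ?thesis
      unfolding l_def s_def[symmetric] by (simp add: mult_left_mono mult.assoc)
  qed
  have "link_sum F x i = l * x i ^ (r - 1)" if "i \<in> V" for i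
  proof (rule deriv_zero_of_power_minimum[OF two_le_r x0[OF that]])
    show "0 \<le> link_sum F x i"
      using x0 subset_V by (intro link_sum_nonneg) blast
  next
    fix t :: real assume "0 \<le> t"
    have norm_upd: "(\<Sum>j\<in>V. (x(i := t)) j ^ r) = t ^ r + (\<Sum>j\<in>V - {i}. x j ^ r)" for t
      using finite_V that by (subst sum.remove[of _ i]) (auto intro!: sum.cong)
    have b: "real r * (\<Sum>S\<in>F. \<Prod>j\<in>S. (x(i := t)) j) \<le> l * (\<Sum>j\<in>V. (x(i := t)) j ^ r)"
      using \<open>0 \<le> t\<close> x0 by (intro bound) auto
    \<comment> \<open>The bound is an equality at \<open>x\<close>. Writing \<open>x\<close> as a
      trivial update lets both sides expand as they do for \<open>t\<close>, and the terms
      independent of coordinate \<open>i\<close> cancel in the comparison.\<close>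
    have e: "real r * (\<Sum>S\<in>F. \<Prod>j\<in>S. (x(i := x i)) j) = l * (\<Sum>j\<in>V. (x(i := x i)) j ^ r)"
      using x1 by (simp add: l_def)
    show "l * x i ^ r - real r * (x i * link_sum F x i)
        \<le> l * t ^ r - real r * (t * link_sum F x i)"
      using b e unfolding norm_upd sum_prod_update distrib_left by linarith
  qed
  moreover have "\<exists>i\<in>V. x i \<noteq> 0"
    using x1 two_le_r by (metis (mono_tags, lifting) sum.neutral zero_neq_one zero_power
        less_le_trans zero_less_numeral)
  ultimately show ?thesis using \<open>0 \<le> l\<close> x0 bound by blast
qed

section \<open>The spectral radius of a uniform family\<close>

text \<open>The triangle inequality turns the eigenvalue equation into an inequality for the moduli
  \<open>y i\<close>. Multiplying by \<open>y i\<close> and summing over \<open>V\<close> produces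
  the form, to which the bound applies.\<close>

lemma tensor_eigenvalue_bound:
  assumes "tensor_eigenvalue V r (family_tensor r F) \<mu>"
    and bound: "\<And>y. (\<forall>i\<in>V. 0 \<le> y i) \<Longrightarrow>
      real r * (\<Sum>S\<in>F. \<Prod>j\<in>S. y j) \<le> l * (\<Sum>i\<in>V. y i ^ r)"
  shows "cmod \<mu> \<le> l"
proof -
  obtain z k where "k \<in> V" "z k \<noteq> 0"
    and z: "\<And>i. i \<in> V \<Longrightarrow> link_sum F z i = \<mu> * z i ^ (r - 1)"
    using assms(1) unfolding tensor_eigenvalue_def by (auto simp: tensor_apply_family)
  define y where "y i = cmod (z i)" for i
  have "cmod \<mu> * y i ^ r \<le> y i * link_sum F y i" if "i \<in> V" for i
  proof -
    have "cmod \<mu> * y i ^ (r - 1) = cmod (link_sum F z i)"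
      using z[OF that] by (simp add: y_def norm_mult norm_power)
    also have "\<dots> \<le> link_sum F y i"
      unfolding link_sum_def y_def prod_norm by (rule norm_sum)
    finally have "y i * (cmod \<mu> * y i ^ (r - 1)) \<le> y i * link_sum F y i"
      by (intro mult_left_mono) (auto simp: y_def)
    then show ?thesis
      using two_le_r by (simp add: power_eq_if[of "y i" r] algebra_simps)
  qed
  then have "cmod \<mu> * (\<Sum>i\<in>V. y i ^ r) \<le> (\<Sum>i\<in>V. y i * link_sum F y i)"
    by (simp add: sum_distrib_left sum_mono)
  also have "\<dots> \<le> l * (\<Sum>i\<in>V. y i ^ r)"
    unfolding sum_mult_link_sum by (rule bound) (simp add: y_def)
  finally have "cmod \<mu> * (\<Sum>i\<in>V. y i ^ r) \<le> l * (\<Sum>i\<in>V. y i ^ r)" .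
  moreover have "0 < (\<Sum>i\<in>V. y i ^ r)"
    using \<open>k \<in> V\<close> \<open>z k \<noteq> 0\<close> finite_V by (intro sum_pos2[of _ k]) (auto simp: y_def)
  ultimately show ?thesis by simp
qed

abbreviation radius :: real where
  "radius \<equiv> tensor_spectral_radius V r (family_tensor r F)"

text \<open>The \<open>l\<close> from \<open>ex_perron_pair\<close> is an eigenvalue and dominates
  the modulus of every other one. Hence the greatest modulus exists and equals
  \<open>l\<close>.\<close>

lemma perron:
  assumes "V \<noteq> {}"
  obtains x where "\<And>i. i \<in> V \<Longrightarrow> 0 \<le> x i" "\<exists>i\<in>V. x i \<noteq> 0"
    "\<And>i. i \<in> V \<Longrightarrow> link_sum F x i = radius * x i ^ (r - 1)"
    "0 \<le> radius"
    "\<And>y. (\<forall>i\<in>V. 0 \<le> y i) \<Longrightarrow>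
      real r * (\<Sum>S\<in>F. \<Prod>j\<in>S. y j) \<le> radius * (\<Sum>i\<in>V. y i ^ r)"
proof -
  obtain l x where "0 \<le> l" and x: "\<And>i. i \<in> V \<Longrightarrow> 0 \<le> x i" "\<exists>i\<in>V. x i \<noteq> 0"
    "\<And>i. i \<in> V \<Longrightarrow> link_sum F x i = l * x i ^ (r - 1)"
    and bound: "\<And>y. (\<forall>i\<in>V. 0 \<le> y i) \<Longrightarrow>
      real r * (\<Sum>S\<in>F. \<Prod>j\<in>S. y j) \<le> l * (\<Sum>i\<in>V. y i ^ r)"
    using ex_perron_pair[OF assms] by blast
  have "tensor_eigenvalue V r (family_tensor r F) (of_real l)"
    unfolding tensor_eigenvalue_def
    using x by (intro exI[of _ "\<lambda>i. of_real (x i)"])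
      (auto simp: tensor_apply_family link_sum_of_real)
  then have "(GREATEST \<rho>. \<exists>\<mu>. tensor_eigenvalue V r (family_tensor r F) \<mu> \<and> \<rho> = cmod \<mu>) = l"
    using \<open>0 \<le> l\<close> bound
    by (intro Greatest_equality)
      (auto intro!: exI[of _ "of_real l"] tensor_eigenvalue_bound)
  then have "radius = l"
    using assms by (simp add: tensor_spectral_radius_def)
  then show thesis using that[of x] x \<open>0 \<le> l\<close> bound by simp
qed

lemma radius_nonneg: "0 \<le> radius"
proof (cases "V = {}")
  case False
  then show ?thesis by (rule perron)
qed (simp add: tensor_spectral_radius_def)

text \<open>Empty \<open>V\<close> is included because the neighborhood of an isolated vertex is
  empty.\<close>

lemma sum_prod_le_radius:
  assumes "\<And>i. i \<in> V \<Longrightarrow> 0 \<le> y i"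
  shows "real r * (\<Sum>S\<in>F. \<Prod>j\<in>S. y j) \<le> radius * (\<Sum>i\<in>V. y i ^ r)"
proof (cases "V = {}")
  case True
  then have "F = {}" using subset_V card_eq two_le_r by fastforce
  then show ?thesis using True by simp
next
  case False
  show ?thesis by (rule perron[OF False]) (use assms in blast)
qed

text \<open>Testing the variational bound on the all-ones vector gives \<open>r * card F\<close> on
  the left, which is positive.\<close>

lemma radius_pos:
  assumes "F \<noteq> {}"
  shows "0 < radius"
proof -
  have "0 < real r * real (card F)"
    using assms finite_F two_le_r by (simp add: card_gt_0_iff)
  also have "\<dots> \<le> radius * real (card V)"
    using sum_prod_le_radius[of "\<lambda>_. 1"] by simp
  finally show ?thesis by (simp add: zero_less_mult_iff)
qed

text \<open>At a largest entry \<open>x v\<close> of the Perron vector each product in the link sum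
  is at most \<open>x v ^ (r - 1)\<close>, a positive factor that cancels.\<close>

lemma ex_degree_ge_radius:
  assumes "V \<noteq> {}"
  shows "\<exists>v\<in>V. radius \<le> real (card {S \<in> F. v \<in> S})"
proof -
  obtain x where x0: "\<And>i. i \<in> V \<Longrightarrow> 0 \<le> x i" and nz: "\<exists>i\<in>V. x i \<noteq> 0"
    and x: "\<And>i. i \<in> V \<Longrightarrow> link_sum F x i = radius * x i ^ (r - 1)"
    using perron[OF assms] by metis
  have "Max (x ` V) \<in> x ` V" using finite_V assms by simp
  then obtain v where "v \<in> V" and v: "\<And>i. i \<in> V \<Longrightarrow> x i \<le> x v"
    using finite_V by (metis (no_types, lifting) Max_ge finite_imageI image_iff)
  have "0 < x v"
    using nz v x0 by (metis less_le_trans less_le)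
  have "radius * x v ^ (r - 1) \<le> (\<Sum>S\<in>{S \<in> F. v \<in> S}. x v ^ (r - 1))"
    unfolding x[OF \<open>v \<in> V\<close>, symmetric] link_sum_def
  proof (rule sum_mono)
    fix S assume S: "S \<in> {S \<in> F. v \<in> S}"
    then have "(\<Prod>j\<in>S - {v}. x j) \<le> (\<Prod>j\<in>S - {v}. x v)"
      using subset_V x0 v by (intro prod_mono) blast
    also have "\<dots> = x v ^ (r - 1)"
      using S finite_member card_eq by (simp add: card_Diff_singleton)
    finally show "(\<Prod>j\<in>S - {v}. x j) \<le> x v ^ (r - 1)" .
  qed
  then show ?thesis using \<open>0 < x v\<close> \<open>v \<in> V\<close> by auto
qed

end

section \<open>Cliques, neighborhoods and links\<close>

text \<open>Induced subgraphs of a graph are graphs, and since \<open>G\<close> has no loops,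
  completeness amounts to adjacency of all distinct pairs.\<close>

lemma cliques_iff:
  assumes "graph G"
  shows "S \<in> cliques r G \<longleftrightarrow>
    S \<subseteq> verts G \<and> card S = r \<and> (\<forall>u\<in>S. \<forall>v\<in>S. u \<noteq> v \<longrightarrow> (u, v) \<in> arcs_ends G)"
proof (cases "S \<subseteq> verts G")
  case True
  interpret graph G by fact
  have "graph (G \<restriction> S)"
  proof unfold_locales
    show "finite (verts (G \<restriction> S))" using finite_subset[OF True finite_verts] by simp
    show "symmetric (G \<restriction> S)"
      using sym_arcs unfolding symmetric_conv by fastforce
  qed (auto simp: no_loops arc_to_ends_def intro: no_multi_arcs)
  moreover have "arcs_ends (G \<restriction> S) = {(u, v) \<in> arcs_ends G. u \<in> S \<and> v \<in> S}"
    by (auto simp: arcs_ends_conv)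
  ultimately have "S \<in> cliques r G \<longleftrightarrow> card S = r \<and>
      {(u, v) \<in> arcs_ends G. u \<in> S \<and> v \<in> S} = {(u, v). (u, v) \<in> S \<times> S \<and> u \<noteq> v}"
    using True by (simp add: cliques_def complete_digraph_def)
  moreover have "(u, v) \<in> arcs_ends G \<Longrightarrow> u \<noteq> v" for u v
    using no_loops by (auto simp: arcs_ends_conv)
  ultimately show ?thesis
    using True by (simp add: set_eq_iff) blast
qed (simp add: cliques_def)

lemma uniform_family_cliques:
  assumes "graph G" "2 \<le> r"
  shows "uniform_family (verts G) (cliques r G) r"
proof -
  interpret graph G by fact
  show ?thesis
    by unfold_locales (use assms cliques_iff[OF assms(1)] in auto)
qed

lemma clique_spectral_radius_family:
  "clique_spectral_radius r G = tensor_spectral_radius (verts G) r (family_tensor r (cliques r G))"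
  unfolding clique_spectral_radius_def
  by (rule arg_cong[of _ _ "tensor_spectral_radius (verts G) r"])
    (auto simp: clique_tensor_def family_tensor_def)

text \<open>Clique sizes are bounded by the number of vertices, so the maximum is attained, and any
  \<open>r\<close> vertices of a maximum clique form an \<open>r\<close>-clique.\<close>

lemma cliques_nonempty:
  assumes "graph G" "r \<le> clique_number G"
  shows "cliques r G \<noteq> {}"
proof -
  interpret graph G by fact
  let ?R = "{r. cliques r G \<noteq> {}}"
  have "?R \<subseteq> {..card (verts G)}"
  proof
    fix k assume "k \<in> ?R"
    then obtain S where "S \<in> cliques k G" by blast
    then show "k \<in> {..card (verts G)}"
      using card_mono[OF finite_verts] by (auto simp: cliques_iff[OF assms(1)])
  qed
  then have "finite ?R" using finite_subset by blast
  moreover have "{} \<in> cliques 0 G" by (simp add: cliques_iff[OF assms(1)])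
  then have "?R \<noteq> {}" by blast
  ultimately have "clique_number G \<in> ?R"
    unfolding clique_number_def by (rule Max_in)
  then obtain S where S: "S \<in> cliques (clique_number G) G" by blast
  then have "r \<le> card S" using assms by (simp add: cliques_iff)
  then obtain T where "T \<subseteq> S" "card T = r"
    using obtain_subset_with_card_n by metis
  then have "T \<in> cliques r G"
    using S unfolding cliques_iff[OF assms(1)] by blast
  then show ?thesis by blast
qed

lemma graph_neighborhood_subgraph:
  assumes "graph G"
  shows "graph (neighborhood_subgraph G u)"
proof -
  interpret graph G by fact
  show ?thesis
    unfolding neighborhood_subgraph_def
  proof unfold_locales
    show "finite (verts (G \<restriction> {v. (v, u) \<in> arcs_ends G}))"
      by (rule finite_subset[OF _ finite_verts]) (auto simp: arcs_ends_conv)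
    show "symmetric (G \<restriction> {v. (v, u) \<in> arcs_ends G})"
      using sym_arcs unfolding symmetric_conv by fastforce
  qed (auto simp: no_loops arc_to_ends_def intro: no_multi_arcs)
qed

lemma graph_clique_edge_subgraph:
  assumes "graph G"
  shows "graph (clique_edge_subgraph r G)"
proof -
  interpret graph G by fact
  show ?thesis
    unfolding clique_edge_subgraph_def
  proof unfold_locales
    let ?H = "G\<lparr>arcs := {e \<in> arcs G. \<exists>K\<in>cliques r G. tail G e \<in> K \<and> head G e \<in> K}\<rparr>"
    show "symmetric ?H"
      unfolding symmetric_conv
    proof
      fix e assume e: "e \<in> arcs ?H"
      then obtain e' where "e' \<in> arcs G" "tail G e = head G e'" "head G e = tail G e'"
        using sym_arcs unfolding symmetric_conv by auto
      then show "\<exists>e'\<in>arcs ?H. tail ?H e = head ?H e' \<and> head ?H e = tail ?H e'"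
        using e by (intro bexI[of _ e']) auto
    qed
  qed (auto simp: no_loops arc_to_ends_def intro: no_multi_arcs)
qed

text \<open>The vertices of \<open>T\<close> are neighbors of \<open>u\<close> exactly when
  \<open>u\<close> can be adjoined to the clique. The condition \<open>0 < r\<close> keeps the
  truncated \<open>r - 1\<close> exact.\<close>

lemma neighborhood_cliques_iff:
  assumes "graph G" "u \<in> verts G" "0 < r"
  shows "T \<in> cliques (r - 1) (neighborhood_subgraph G u) \<longleftrightarrow> u \<notin> T \<and> insert u T \<in> cliques r G"
proof -
  interpret graph G by fact
  let ?N = "{v. (v, u) \<in> arcs_ends G}"
  have loop: "(u, u) \<notin> arcs_ends G"
    using no_loops by (auto simp: arcs_ends_conv)
  have sym: "(u, v) \<in> arcs_ends G" if "(v, u) \<in> arcs_ends G" for v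
    using that by (rule arcs_ends_symmetric[OF sym_arcs])
  have N: "?N \<subseteq> verts G" by (auto simp: arcs_ends_conv)
  have ends: "arcs_ends (neighborhood_subgraph G u) = {(v, w) \<in> arcs_ends G. v \<in> ?N \<and> w \<in> ?N}"
    unfolding neighborhood_subgraph_def by (auto simp: arcs_ends_conv)
  have verts: "verts (neighborhood_subgraph G u) = ?N"
    by (simp add: neighborhood_subgraph_def)
  show ?thesis
  proof
    assume "T \<in> cliques (r - 1) (neighborhood_subgraph G u)"
    then have T: "T \<subseteq> ?N" "card T = r - 1"
      "\<And>v w. \<lbrakk>v \<in> T; w \<in> T; v \<noteq> w\<rbrakk> \<Longrightarrow> (v, w) \<in> arcs_ends G"
      unfolding cliques_iff[OF graph_neighborhood_subgraph[OF assms(1)]] ends verts by auto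
    then have "u \<notin> T" using loop by blast
    moreover have "finite T"
      by (rule finite_subset[OF subset_trans[OF T(1) N] finite_verts])
    ultimately show "u \<notin> T \<and> insert u T \<in> cliques r G"
      using T N sym assms unfolding cliques_iff[OF assms(1)] by auto
  next
    assume A: "u \<notin> T \<and> insert u T \<in> cliques r G"
    then have T: "T \<subseteq> verts G" "card (insert u T) = r"
      "\<And>v w. \<lbrakk>v \<in> insert u T; w \<in> insert u T; v \<noteq> w\<rbrakk> \<Longrightarrow> (v, w) \<in> arcs_ends G"
      unfolding cliques_iff[OF assms(1)] by auto
    have "finite T" using T finite_verts finite_subset by blast
    then have "card T = r - 1" using T A by auto
    moreover have "T \<subseteq> ?N" using T A by auto
    ultimately show "T \<in> cliques (r - 1) (neighborhood_subgraph G u)"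
      using T unfolding cliques_iff[OF graph_neighborhood_subgraph[OF assms(1)]] ends verts by auto
  qed
qed

lemma bij_betw_insert_neighborhood_cliques:
  assumes "graph G" "u \<in> verts G" "0 < r"
  shows "bij_betw (insert u) (cliques (r - 1) (neighborhood_subgraph G u)) {S \<in> cliques r G. u \<in> S}"
  by (rule bij_betw_byWitness[where f' = "\<lambda>S. S - {u}"])
    (auto simp: neighborhood_cliques_iff[OF assms] insert_absorb simp del: One_nat_def)

text \<open>This turns the eigenvalue equation of \<open>G\<close> at \<open>u\<close> into a
  statement about the form of the neighborhood of \<open>u\<close>, to which the bound by its radius
  applies.\<close>

lemma link_sum_cliques:
  assumes "graph G" "u \<in> verts G" "0 < r"
  shows "link_sum (cliques r G) x u
    = (\<Sum>T\<in>cliques (r - 1) (neighborhood_subgraph G u). \<Prod>j\<in>T. x j)"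
proof -
  have "link_sum (cliques r G) x u
      = (\<Sum>T\<in>cliques (r - 1) (neighborhood_subgraph G u). \<Prod>j\<in>insert u T - {u}. x j)"
    unfolding link_sum_def
    by (rule sum.reindex_bij_betw[OF bij_betw_insert_neighborhood_cliques[OF assms], symmetric])
  also have "\<dots> = (\<Sum>T\<in>cliques (r - 1) (neighborhood_subgraph G u). \<Prod>j\<in>T. x j)"
    by (intro sum.cong) (auto simp: neighborhood_cliques_iff[OF assms] simp del: One_nat_def)
  finally show ?thesis .
qed

text \<open>For edges the link sum is the action of the adjacency matrix: the 1-cliques of a
  neighborhood are its singletons.\<close>

lemma link_sum_edges:
  assumes "graph G" "u \<in> verts G"
  shows "link_sum (cliques 2 G) x u = (\<Sum>v\<in>{v. (v, u) \<in> arcs_ends G}. x v)"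
proof -
  interpret graph G by fact
  let ?N = "{v. (v, u) \<in> arcs_ends G}"
  have "cliques (2 - 1) (neighborhood_subgraph G u) = (\<lambda>v. {v}) ` ?N"
    unfolding set_eq_iff cliques_iff[OF graph_neighborhood_subgraph[OF assms(1)]]
    by (auto simp: neighborhood_subgraph_def card_1_singleton_iff)
  then show ?thesis
    by (simp add: link_sum_cliques[OF assms] sum.reindex inj_on_def)
qed

section \<open>Comparing the radii of \<open>G\<close>, its neighborhoods and
  \<open>H\<close>\<close>

lemma ex_neighborhood_radius_ge:
  assumes "graph G" "3 \<le> r" "cliques r G \<noteq> {}"
  shows "\<exists>u\<in>verts G. real (r - 1) * clique_ratio r G
    \<le> clique_spectral_radius (r - 1) (neighborhood_subgraph G u)"
proof -
  interpret graph G by fact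
  define H where "H = clique_edge_subgraph r G"
  define \<rho> where "\<rho> = clique_spectral_radius r G"
  define \<sigma> where "\<sigma> = clique_spectral_radius 2 H"
  define \<tau> where "\<tau> u = clique_spectral_radius (r - 1) (neighborhood_subgraph G u)" for u
  have H: "graph H" unfolding H_def by (rule graph_clique_edge_subgraph[OF assms(1)])
  have verts_H: "verts H = verts G" by (simp add: H_def clique_edge_subgraph_def)
  have ends_H: "(v, w) \<in> arcs_ends H \<longleftrightarrow>
      (v, w) \<in> arcs_ends G \<and> (\<exists>K\<in>cliques r G. v \<in> K \<and> w \<in> K)" for v w
    by (auto simp: H_def clique_edge_subgraph_def arcs_ends_conv)
  interpret FG: uniform_family "verts G" "cliques r G" r
    by (rule uniform_family_cliques) (use assms in auto)
  interpret FH: uniform_family "verts G" "cliques 2 H" 2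
    using uniform_family_cliques[OF H, of 2] by (simp add: verts_H)
  have \<rho>: "\<rho> = FG.radius" unfolding \<rho>_def by (rule clique_spectral_radius_family)
  have \<sigma>: "\<sigma> = FH.radius" unfolding \<sigma>_def clique_spectral_radius_family verts_H ..
  obtain K where K: "K \<in> cliques r G" using assms by blast
  then have "K \<subseteq> verts G" "card K = r"
    and K_ends: "\<And>v w. \<lbrakk>v \<in> K; w \<in> K; v \<noteq> w\<rbrakk> \<Longrightarrow> (v, w) \<in> arcs_ends G"
    by (auto simp: cliques_iff[OF assms(1)])
  then have "verts G \<noteq> {}" using assms by auto
  \<comment> \<open>Two vertices of an \<open>r\<close>-clique span an edge that survives in
    \<open>H\<close>, which makes the denominator \<open>\<sigma>\<close> positive.\<close>
  obtain e where e: "e \<subseteq> K" "card e = 2"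
    using obtain_subset_with_card_n[of 2 K] \<open>card K = r\<close> assms by auto
  have "(v, w) \<in> arcs_ends H" if "v \<in> K" "w \<in> K" "v \<noteq> w" for v w
    using that K K_ends[OF that] unfolding ends_H by blast
  then have "e \<in> cliques 2 H"
    using e \<open>K \<subseteq> verts G\<close> unfolding cliques_iff[OF H] verts_H by auto
  then have "0 < \<sigma>" unfolding \<sigma> by (intro FH.radius_pos) blast
  obtain x where x0: "\<And>i. i \<in> verts G \<Longrightarrow> 0 \<le> x i" and nz: "\<exists>i\<in>verts G. x i \<noteq> 0"
    and x: "\<And>i. i \<in> verts G \<Longrightarrow> link_sum (cliques r G) x i = \<rho> * x i ^ (r - 1)"
    using FG.perron[OF \<open>verts G \<noteq> {}\<close>] unfolding \<rho> by metis
  \<comment> \<open>The \<open>(r - 1)\<close>-th power sum of \<open>x\<close> over neighbors is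
    linear in \<open>z\<close>, so the adjacency operator of \<open>H\<close> can act on it.\<close>
  define z where "z i = x i ^ (r - 1)" for i
  have z0: "0 \<le> z i" if "i \<in> verts G" for i using x0[OF that] by (simp add: z_def)
  have local: "real (r - 1) * (\<rho> * z u) \<le> \<tau> u * link_sum (cliques 2 H) z u"
    if u: "u \<in> verts G" for u
  proof -
    let ?Gu = "neighborhood_subgraph G u"
    let ?N = "{v. (v, u) \<in> arcs_ends G}" and ?M = "{v. (v, u) \<in> arcs_ends H}"
    have verts_Gu: "verts ?Gu = ?N" by (simp add: neighborhood_subgraph_def)
    have "?N \<subseteq> verts G" by (auto simp: arcs_ends_conv)
    have "?M \<subseteq> ?N" using ends_H by blast
    have "finite ?N" using \<open>?N \<subseteq> verts G\<close> finite_verts finite_subset by blast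
    interpret FU: uniform_family ?N "cliques (r - 1) ?Gu" "r - 1"
      using uniform_family_cliques[OF graph_neighborhood_subgraph[OF assms(1)], of "r - 1" u] assms
      by (simp add: verts_Gu)
    have \<tau>: "\<tau> u = FU.radius" unfolding \<tau>_def clique_spectral_radius_family verts_Gu ..
    \<comment> \<open>A neighbor of \<open>u\<close> that is not joined to \<open>u\<close> in
      \<open>H\<close> lies in no \<open>(r - 1)\<close>-clique of \<open>?Gu\<close>. Setting its
      entry to 0 preserves the form and cuts the power sum down to the neighbors in
      \<open>H\<close>.\<close>
    let ?y = "\<lambda>v. if v \<in> ?M then x v else 0"
    have "(\<Prod>j\<in>T. x j) = (\<Prod>j\<in>T. ?y j)" if "T \<in> cliques (r - 1) ?Gu" for T
    proof (rule prod.cong)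
      fix j assume "j \<in> T"
      have "u \<notin> T" "insert u T \<in> cliques r G"
        using that neighborhood_cliques_iff[OF assms(1) u] assms by auto
      moreover from this have "(j, u) \<in> arcs_ends G"
        using \<open>j \<in> T\<close> by (auto simp: cliques_iff[OF assms(1)])
      ultimately have "j \<in> ?M"
        using \<open>j \<in> T\<close> unfolding mem_Collect_eq ends_H
        by (intro conjI bexI[of _ "insert u T"]) auto
      then show "x j = ?y j" by simp
    qed simp
    then have "link_sum (cliques r G) x u = (\<Sum>T\<in>cliques (r - 1) ?Gu. \<Prod>j\<in>T. ?y j)"
      using link_sum_cliques[OF assms(1) u, of r x] assms by simp
    then have "real (r - 1) * (\<rho> * z u) = real (r - 1) * (\<Sum>T\<in>cliques (r - 1) ?Gu. \<Prod>j\<in>T. ?y j)"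
      using x[OF u] by (simp add: z_def)
    also have "\<dots> \<le> FU.radius * (\<Sum>v\<in>?N. ?y v ^ (r - 1))"
      using x0 \<open>?N \<subseteq> verts G\<close> by (intro FU.sum_prod_le_radius) auto
    also have "(\<Sum>v\<in>?N. ?y v ^ (r - 1)) = (\<Sum>v\<in>?M. z v)"
      using \<open>?M \<subseteq> ?N\<close> \<open>finite ?N\<close> assms
      by (intro sum.mono_neutral_cong_right) (auto simp: z_def zero_power)
    also have "\<dots> = link_sum (cliques 2 H) z u"
      using link_sum_edges[OF H, of u z] u by (simp add: verts_H)
    finally show ?thesis unfolding \<tau> .
  qed
  have "Max (\<tau> ` verts G) \<in> \<tau> ` verts G" using \<open>verts G \<noteq> {}\<close> by simp
  then obtain u where u: "u \<in> verts G" and umax: "\<And>v. v \<in> verts G \<Longrightarrow> \<tau> v \<le> \<tau> u"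
    using finite_verts by (metis (no_types, lifting) Max_ge finite_imageI image_iff)
  have "0 \<le> \<tau> u"
  proof -
    interpret FU: uniform_family "verts (neighborhood_subgraph G u)"
      "cliques (r - 1) (neighborhood_subgraph G u)" "r - 1"
      by (rule uniform_family_cliques[OF graph_neighborhood_subgraph[OF assms(1)]])
        (use assms in auto)
    show ?thesis unfolding \<tau>_def clique_spectral_radius_family by (rule FU.radius_nonneg)
  qed
  \<comment> \<open>The local inequalities are summed with the nonnegative weights
    \<open>z v\<close>, after \<open>\<tau> v\<close> is replaced by its maximum
    \<open>\<tau> u\<close>.\<close>
  have "real (r - 1) * \<rho> * (\<Sum>v\<in>verts G. z v ^ 2)
      = (\<Sum>v\<in>verts G. z v * (real (r - 1) * (\<rho> * z v)))"
    by (simp add: sum_distrib_left power2_eq_square algebra_simps)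
  also have "\<dots> \<le> (\<Sum>v\<in>verts G. z v * (\<tau> u * link_sum (cliques 2 H) z v))"
  proof (intro sum_mono mult_left_mono z0)
    fix v assume v: "v \<in> verts G"
    have "0 \<le> link_sum (cliques 2 H) z v"
      using FH.subset_V z0 by (intro link_sum_nonneg) blast
    then have "\<tau> v * link_sum (cliques 2 H) z v \<le> \<tau> u * link_sum (cliques 2 H) z v"
      by (intro mult_right_mono umax v)
    with local[OF v]
    show "real (r - 1) * (\<rho> * z v) \<le> \<tau> u * link_sum (cliques 2 H) z v" by linarith
  qed
  also have "\<dots> = \<tau> u * (\<Sum>v\<in>verts G. z v * link_sum (cliques 2 H) z v)"
    by (simp add: sum_distrib_left algebra_simps)
  \<comment> \<open>The weighted sum of link sums is the quadratic form of \<open>H\<close> at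
    \<open>z\<close>, bounded through its radius \<open>\<sigma>\<close>.\<close>
  also have "\<dots> \<le> \<tau> u * (\<sigma> * (\<Sum>v\<in>verts G. z v ^ 2))"
    unfolding FH.sum_mult_link_sum \<sigma>
    by (intro mult_left_mono FH.sum_prod_le_radius z0 \<open>0 \<le> \<tau> u\<close>)
  finally have "real (r - 1) * \<rho> * (\<Sum>v\<in>verts G. z v ^ 2)
      \<le> \<tau> u * \<sigma> * (\<Sum>v\<in>verts G. z v ^ 2)" by (simp add: mult.assoc)
  moreover have "0 < (\<Sum>v\<in>verts G. z v ^ 2)"
  proof -
    obtain k where "k \<in> verts G" "x k \<noteq> 0" using nz by blast
    then show ?thesis by (intro sum_pos2[of _ k]) (auto simp: z_def)
  qed
  ultimately have "real (r - 1) * \<rho> \<le> \<tau> u * \<sigma>" by simp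
  then have "real (r - 1) * (\<rho> / \<sigma>) \<le> \<tau> u"
    using \<open>0 < \<sigma>\<close> by (simp add: field_simps)
  then show ?thesis
    using u unfolding clique_ratio_def \<rho>_def \<sigma>_def \<tau>_def H_def by blast
qed

section \<open>Positive ratio and cliques through a common edge\<close>

text \<open>Both the \<open>r\<close>-cliques of \<open>G\<close> and the edges of \<open>H\<close>
  are nonempty families, so both radii are positive. This makes the number of cliques chosen in the
  theorem at least 1.\<close>

lemma clique_ratio_pos:
  assumes "graph G" "2 \<le> r" "cliques r G \<noteq> {}"
  shows "0 < clique_ratio r G"
proof -
  let ?H = "clique_edge_subgraph r G"
  have H: "graph ?H" by (rule graph_clique_edge_subgraph[OF assms(1)])
  interpret FG: uniform_family "verts G" "cliques r G" r
    by (rule uniform_family_cliques) (use assms in auto)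
  interpret FH: uniform_family "verts ?H" "cliques 2 ?H" 2
    by (rule uniform_family_cliques[OF H]) simp
  obtain K where K: "K \<in> cliques r G" using assms by blast
  then have "K \<subseteq> verts G" "card K = r"
    and K_ends: "\<And>v w. \<lbrakk>v \<in> K; w \<in> K; v \<noteq> w\<rbrakk> \<Longrightarrow> (v, w) \<in> arcs_ends G"
    by (auto simp: cliques_iff[OF assms(1)])
  obtain e where e: "e \<subseteq> K" "card e = 2"
    using obtain_subset_with_card_n[of 2 K] \<open>card K = r\<close> assms by auto
  have "(v, w) \<in> arcs_ends ?H" if "v \<in> K" "w \<in> K" "v \<noteq> w" for v w
    using that K K_ends[OF that] by (auto simp: clique_edge_subgraph_def arcs_ends_conv)
  then have "e \<in> cliques 2 ?H"
    using e \<open>K \<subseteq> verts G\<close> unfolding cliques_iff[OF H]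
    by (auto simp: clique_edge_subgraph_def)
  then have "0 < FH.radius" by (intro FH.radius_pos) blast
  moreover have "0 < FG.radius" using assms by (intro FG.radius_pos)
  ultimately show ?thesis
    unfolding clique_ratio_def clique_spectral_radius_family by simp
qed

theorem theorem4p1:
  fixes G :: "('a, 'b) pre_digraph" and r :: nat
  assumes "graph G"
    and "3 \<le> r"
    and "r \<le> clique_number G"
  shows "\<exists>u \<in> verts G.
    clique_spectral_radius (r - 1) (neighborhood_subgraph G u) \<ge> real (r - 1) * clique_ratio r G \<and>
    (\<exists>\<C> \<subseteq> cliques r G.
       int (card \<C>) = \<lceil>real (r - 1) * clique_ratio r G\<rceil> \<and>
       u \<in> \<Inter>\<C> \<and> card (\<Inter>\<C>) \<ge> 2)"
proof -
  define g where "g = real (r - 1) * clique_ratio r G"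
  interpret graph G by fact
  have ne: "cliques r G \<noteq> {}" using assms(1,3) by (rule cliques_nonempty)
  obtain u where u: "u \<in> verts G"
    and ge: "g \<le> clique_spectral_radius (r - 1) (neighborhood_subgraph G u)"
    using ex_neighborhood_radius_ge[OF assms(1,2) ne] unfolding g_def by blast
  let ?Gu = "neighborhood_subgraph G u"
  have "0 < g" using clique_ratio_pos[OF assms(1) _ ne] assms(2) by (simp add: g_def)
  interpret FU: uniform_family "verts ?Gu" "cliques (r - 1) ?Gu" "r - 1"
    by (rule uniform_family_cliques[OF graph_neighborhood_subgraph[OF assms(1)]])
      (use assms in auto)
  have "g \<le> FU.radius" using ge by (simp add: clique_spectral_radius_family)
  with \<open>0 < g\<close> have "0 < FU.radius" by linarith
  \<comment> \<open>Over an empty vertex set the spectral radius is 0 by convention.\<close>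
  then have "verts ?Gu \<noteq> {}" by (auto simp: tensor_spectral_radius_def)
  then obtain v where v: "v \<in> verts ?Gu"
    and "FU.radius \<le> real (card {T \<in> cliques (r - 1) ?Gu. v \<in> T})"
    using FU.ex_degree_ge_radius by blast
  define p where "p = nat \<lceil>g\<rceil>"
  have p: "int p = \<lceil>g\<rceil>" "0 < p" using \<open>0 < g\<close> by (auto simp: p_def)
  \<comment> \<open>An integer that is at least \<open>g\<close> is at least its ceiling.\<close>
  have "p \<le> card {T \<in> cliques (r - 1) ?Gu. v \<in> T}"
    using \<open>g \<le> FU.radius\<close> \<open>FU.radius \<le> _\<close> unfolding p_def by linarith
  then obtain \<D> where \<D>: "\<D> \<subseteq> {T \<in> cliques (r - 1) ?Gu. v \<in> T}" "card \<D> = p"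
    by (rule obtain_subset_with_card_n) blast
  let ?C = "insert u ` \<D>"
  have bij: "bij_betw (insert u) (cliques (r - 1) ?Gu) {S \<in> cliques r G. u \<in> S}"
    by (rule bij_betw_insert_neighborhood_cliques[OF assms(1) u]) (use assms in simp)
  have "?C \<subseteq> cliques r G" using \<D> bij by (auto simp: bij_betw_def)
  moreover have "card ?C = p"
  proof -
    have "inj_on (insert u) \<D>"
      using bij \<D>(1) unfolding bij_betw_def by (blast intro: inj_on_subset)
    then show ?thesis using \<D>(2) by (simp add: card_image)
  qed
  moreover have "u \<in> \<Inter>?C" by blast
  moreover have "2 \<le> card (\<Inter>?C)"
  proof -
    \<comment> \<open>Since \<open>p\<close> is positive there is a member to bound the
      intersection. Its finiteness matters, as \<open>card\<close> is 0 on infinite sets.\<close>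
    obtain T where "T \<in> \<D>" using \<D> p by fastforce
    then have "insert u T \<in> cliques r G" using \<open>?C \<subseteq> cliques r G\<close> by blast
    then have "insert u T \<subseteq> verts G" by (simp add: cliques_iff[OF assms(1)])
    then have "finite (insert u T)" using finite_verts by (rule finite_subset)
    then have "finite (\<Inter>?C)" using \<open>T \<in> \<D>\<close> by (meson INT_lower finite_subset)
    moreover have "(u, u) \<notin> arcs_ends G" using no_loops by (auto simp: arcs_ends_conv)
    then have "u \<noteq> v" using v by (auto simp: neighborhood_subgraph_def)
    moreover have "{u, v} \<subseteq> \<Inter>?C" using \<D> by blast
    ultimately show ?thesis by (metis card_2_iff card_mono)
  qed
  ultimately have "?C \<subseteq> cliques r G \<and> int (card ?C) = \<lceil>g\<rceil> \<and> u \<in> \<Inter>?C \<and> 2 \<le> card (\<Inter>?C)"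
    using p(1) by simp
  then show ?thesis using u ge unfolding g_def by blast
qed

end
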